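(* Let $k\ge2$ be an integer, let $X_1,\ldots,X_{k+1}$ be i.i.d. standard exponential random variables (density $e^{-x}$, $x\ge0$), and let $\Psi_k$ be the kernel defined in the context. Then the projection $\psi_k(s)=E\left(\Psi_k(X_1,\ldots,X_{k+1})\mid X_{k+1}=s\right)$ equals $$\psi_k(s)=\frac{1-(1-e^{-s})^k}{k+1}-\frac1{(k+1)^2}\sum_{r=1}^k\left(1+\frac1r\right)e^{-s/r},\quad s\ge0.$$ Moreover $E(\psi_k(X_1))=0$, and the variance of the projection, $\Delta_k^2=\operatorname{Var}(\psi_k(X_1))$, equals $$\Delta_k^2=\frac1{(k+1)^3}\left[\frac{-12k^4-38k^3-35k^2-11k}{4(k+1)^2(k+2)(2k+1)}+2\,k!\sum_{r=1}^k\frac1{(k+1+\frac1r)(k+\frac1r)\cdots(2+\frac1r)}+\frac2{k+1}\sum_{1\le i<j\le k}\frac1{i+j+ij}\right].$$ The kernel $\Psi_k$ is non-degenerate, i.e. $\Delta_k^2>0$, for every $k\ge2$.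
   Context: The kernel is $$\Psi_k(x_1,\ldots,x_{k+1})=\frac1{k+1}\left[\sum_{i=1}^{k+1}\mathbf 1\left\{\max_{m\ne i}x_m<x_i\right\}-\frac1{k!}\sum_{i=1}^{k+1}\ \sum_{\pi}\mathbf 1\left\{\sum_{m\neq i}\frac{x_m}{\pi(m)}<x_i\right\}\right],$$ where $m$ ranges over $\{1,\ldots,k+1\}\setminus\{i\}$ and, for each $i$, the sum over $\pi$ runs over all $k!$ bijections $\pi:\{1,\ldots,k+1\}\setminus\{i\}\to\{1,\ldots,k\}$. *)

theory Defs
  imports "HOL-Probability.Probability"
begin

text \<open>
  The kernel. Only the values of x on \<open>{1..k+1}\<close> matter. The bijections are taken to be
  extensional functions, so that there are exactly \<open>fact k\<close> of them for each i.
\<close>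

definition rank_bijections :: "nat \<Rightarrow> nat \<Rightarrow> (nat \<Rightarrow> nat) set" where
  "rank_bijections k i =
     {\<pi> \<in> ({1..k+1} - {i}) \<rightarrow>\<^sub>E {1..k}. bij_betw \<pi> ({1..k+1} - {i}) {1..k}}"

definition Psi :: "nat \<Rightarrow> (nat \<Rightarrow> real) \<Rightarrow> real" where
  "Psi k x =
     1 / real (k+1) *
       ((\<Sum>i=1..k+1. of_bool (Max (x ` ({1..k+1} - {i})) < x i))
        - 1 / fact k *
            (\<Sum>i=1..k+1. \<Sum>\<pi>\<in>rank_bijections k i.
               of_bool ((\<Sum>m\<in>{1..k+1} - {i}. x m / real (\<pi> m)) < x i)))"

text \<open>g is a version of \<open>s \<mapsto> E(Z | Y = s)\<close>.\<close>

definition is_cond_exp_given ::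
    "'a measure \<Rightarrow> ('a \<Rightarrow> real) \<Rightarrow> ('a \<Rightarrow> real) \<Rightarrow> (real \<Rightarrow> real) \<Rightarrow> bool" where
  "is_cond_exp_given M Z Y g \<longleftrightarrow>
     integrable M Z \<and> g \<in> borel_measurable borel \<and>
     (AE \<omega> in M. real_cond_exp M (vimage_algebra (space M) Y borel) Z \<omega> = g (Y \<omega>))"

text \<open>
  \<open>E(\<Psi>\<^sub>k(X\<^sub>1, \<dots>, X\<^sub>k\<^sub>+\<^sub>1) | X\<^sub>k\<^sub>+\<^sub>1 = s)\<close> is determined only for almost every s. The version
  meant by a formula for every s is the one obtained by substituting s for the last argument
  and integrating over the others.
\<close>

definition psi :: "'a measure \<Rightarrow> (nat \<Rightarrow> 'a \<Rightarrow> real) \<Rightarrow> nat \<Rightarrow> real \<Rightarrow> real" where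
  "psi M X k s = prob_space.expectation M (\<lambda>\<omega>. Psi k ((\<lambda>i. X i \<omega>)(k+1 := s)))"

definition Delta_sq :: "'a measure \<Rightarrow> (nat \<Rightarrow> 'a \<Rightarrow> real) \<Rightarrow> nat \<Rightarrow> real" where
  "Delta_sq M X k = prob_space.variance M (\<lambda>\<omega>. psi M X k (X 1 \<omega>))"

end

theory Submission
  imports Defs
begin

text \<open>
  Why the theorem holds. Freeze the last argument of the kernel at \<open>s\<close>.

  Almost surely the \<open>k+1\<close> arguments are pairwise distinct, so exactly one of them is the strict
  maximum and the first sum in the kernel is 1 (\<open>sum_strict_max_indicators\<close>).

  In the second sum the frozen variable is treated differently from the others. For \<open>i = k+1\<close>, Renyi's
  representation says that \<open>\<Sum>r\<le>k. E\<^sub>r / r\<close> of independent standard exponentials is distributed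
  as their maximum, so each bijection contributes \<open>(1 - exp (- s)) ^ k\<close>
  (\<open>renyi_sum_cdf\<close>). For \<open>i \<le> k\<close>, the exponential tail turns the probability that \<open>X\<^sub>i\<close>
  exceeds an independent nonnegative sum into the Laplace transform of that sum at 1
  (\<open>std_exponential_greater_prob\<close>); this factorises, and the factors
  \<open>r / (r + 1)\<close> telescope. The result depends on the bijection only through the rank \<open>r\<close> that it gives
  to \<open>k+1\<close>, and averaging over bijections makes that rank uniform
  (\<open>sum_rank_bijections_eval\<close>). Together these give the closed form
  (\<open>psi_eq_projection_formula\<close>). That the frozen expectation is a version of the
  conditional expectation is Fubini's theorem for the independent pair formed by the last variable and the
  vector of the others.

  The closed form is a linear combination of terms \<open>(1 - exp (- s)) ^ n * exp (- a * s)\<close>, whose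
  exponential expectation is a Beta integral (\<open>std_exponential_beta\<close>). Squaring, integrating termwise and
  splitting the double sum over ranks into its telescoping diagonal and twice its upper triangle gives the
  variance. It is positive because the closed form is continuous and at \<open>s = 0\<close> takes the value
  \<open>(1 - H\<^sub>k) / (k+1)\<^sup>2\<close>, where the harmonic number \<open>H\<^sub>k\<close> exceeds 1 for \<open>k \<ge> 2\<close>.
\<close>

section \<open>Freezing one of two independent variables\<close>

text \<open>
  This form of Fubini's theorem gives the absence of ties, the comparison probabilities, the convolution
  step and the conditional expectation. Both variables take values
  in the same type because \<open>indep_var\<close> requires it.
\<close>

lemma (in prob_space)
  fixes h :: "'b \<Rightarrow> 'b \<Rightarrow> real"
  assumes indep: "indep_var S X T Y"
    and h: "case_prod h \<in> borel_measurable (S \<Otimes>\<^sub>M T)"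
    and bound: "\<And>x y. x \<in> space S \<Longrightarrow> y \<in> space T \<Longrightarrow> \<bar>h x y\<bar> \<le> C"
  shows borel_measurable_freeze: "(\<lambda>x. expectation (\<lambda>\<omega>. h x (Y \<omega>))) \<in> borel_measurable S"
    and expectation_freeze:
      "expectation (\<lambda>\<omega>. h (X \<omega>) (Y \<omega>)) = expectation (\<lambda>\<omega>. expectation (\<lambda>\<omega>'. h (X \<omega>) (Y \<omega>')))"
proof -
  have rv[measurable]: "random_variable S X" "random_variable T Y"
    using indep by (blast dest: indep_var_rv1 indep_var_rv2)+
  note h[measurable]
  have D: "distr M S X \<Otimes>\<^sub>M distr M T Y = distr M (S \<Otimes>\<^sub>M T) (\<lambda>x. (X x, Y x))"
    using indep by (simp add: indep_var_distribution_eq)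
  interpret P1: prob_space "distr M S X" by (rule prob_space_distr) fact
  interpret P2: prob_space "distr M T Y" by (rule prob_space_distr) fact
  interpret P: pair_prob_space "distr M S X" "distr M T Y" ..
  have inner: "(\<integral>y. h x y \<partial>distr M T Y) = expectation (\<lambda>\<omega>. h x (Y \<omega>))" if "x \<in> space S" for x
    using that by (subst integral_distr) auto
  have meas: "(\<lambda>x. \<integral>y. h x y \<partial>distr M T Y) \<in> borel_measurable S"
    by (rule P2.borel_measurable_lebesgue_integral) simp
  show meas': "(\<lambda>x. expectation (\<lambda>\<omega>. h x (Y \<omega>))) \<in> borel_measurable S"
    using meas by (subst measurable_cong[OF inner[symmetric]]) auto
  have int: "integrable (distr M S X \<Otimes>\<^sub>M distr M T Y) (case_prod h)"
    by (rule P.integrable_const_bound[where B = C])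
       (use bound in \<open>auto intro!: AE_I2 simp: space_pair_measure\<close>)
  have "expectation (\<lambda>\<omega>. h (X \<omega>) (Y \<omega>)) = (\<integral>z. case_prod h z \<partial>(distr M S X \<Otimes>\<^sub>M distr M T Y))"
    unfolding D by (subst integral_distr) auto
  also have "\<dots> = (\<integral>x. (\<integral>y. h x y \<partial>distr M T Y) \<partial>distr M S X)"
    using P.integral_fst'[OF int] by simp
  also have "\<dots> = (\<integral>x. expectation (\<lambda>\<omega>. h x (Y \<omega>)) \<partial>distr M S X)"
    by (intro Bochner_Integration.integral_cong refl inner) simp
  also have "\<dots> = expectation (\<lambda>\<omega>. expectation (\<lambda>\<omega>'. h (X \<omega>) (Y \<omega>')))"
    using meas' by (subst integral_distr) auto
  finally show "expectation (\<lambda>\<omega>. h (X \<omega>) (Y \<omega>)) =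
    expectation (\<lambda>\<omega>. expectation (\<lambda>\<omega>'. h (X \<omega>) (Y \<omega>')))" .
qed

section \<open>Standard exponential variables\<close>

context prob_space
begin

lemma std_exponential_nonneg:
  assumes "distributed M lborel X (exponential_density 1)"
  shows "AE \<omega> in M. 0 \<le> X \<omega>"
  by (subst distributed_AE2[OF assms]) (auto simp: exponential_density_def)

lemma std_exponential_tail:
  assumes D: "distributed M lborel X (exponential_density 1)" and "0 \<le> a"
  shows "expectation (\<lambda>\<omega>. of_bool (a < X \<omega>)) = exp (- a)"
proof -
  have [measurable]: "random_variable borel X"
    using distributed_measurable[OF D] by simp
  have "expectation (\<lambda>\<omega>. of_bool (a < X \<omega>)) = expectation (indicator {\<omega> \<in> space M. a < X \<omega>})"
    by (intro Bochner_Integration.integral_cong) (auto simp: indicator_def)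
  also have "\<dots> = exp (- a)"
    using exponential_distributedD_gt[OF D \<open>0 \<le> a\<close>] by simp
  finally show ?thesis .
qed

text \<open>Multiplying the density by \<open>exp (- a x)\<close> turns it into a multiple of the
  exponential density of rate \<open>1 + a\<close>.\<close>

lemma std_exponential_laplace:
  assumes D: "distributed M lborel X (exponential_density 1)" and a: "0 \<le> a"
  shows "expectation (\<lambda>\<omega>. exp (- a * X \<omega>)) = 1 / (1 + a)"
proof -
  interpret E: prob_space "density lborel (exponential_density (1 + a))"
    using a by (intro prob_space_exponential_density) simp
  have "integral\<^sup>L (density lborel (exponential_density (1 + a))) (\<lambda>x. 1 :: real) = 1"
    using E.prob_space by simp
  hence one: "(\<integral>x. exponential_density (1 + a) x \<partial>lborel) = 1"
    using a by (subst (asm) integral_real_density) auto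
  have "expectation (\<lambda>\<omega>. exp (- a * X \<omega>)) = (\<integral>x. exponential_density 1 x * exp (- a * x) \<partial>lborel)"
    by (rule distributed_integral[OF D, symmetric]) auto
  also have "\<dots> = (\<integral>x. 1 / (1 + a) * exponential_density (1 + a) x \<partial>lborel)"
    using a by (intro Bochner_Integration.integral_cong)
      (auto simp: exponential_density_def field_simps simp flip: exp_add)
  also have "\<dots> = 1 / (1 + a)"
    by (subst integral_mult_right_zero) (simp add: one)
  finally show ?thesis .
qed

text \<open>
  In the variable \<open>u = exp (- x)\<close> this is the Beta integral of \<open>(1 - u) ^ n * u powr a\<close> over the unit
  interval. The induction splits off one factor \<open>1 - u\<close>, which relates exponent \<open>n + 1\<close> at \<open>a\<close> to exponent
  \<open>n\<close> at \<open>a\<close> and \<open>a + 1\<close>.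
\<close>

lemma std_exponential_beta:
  assumes D: "distributed M lborel X (exponential_density 1)" and a: "0 \<le> a"
  shows "integrable M (\<lambda>\<omega>. (1 - exp (- X \<omega>)) ^ n * exp (- a * X \<omega>)) \<and>
    expectation (\<lambda>\<omega>. (1 - exp (- X \<omega>)) ^ n * exp (- a * X \<omega>)) = fact n / (\<Prod>j=1..n+1. real j + a)"
  using a
proof (induction n arbitrary: a)
  case 0
  have [measurable]: "random_variable borel X"
    using distributed_measurable[OF D] by simp
  have "integrable M (\<lambda>\<omega>. exp (- a * X \<omega>))"
    using std_exponential_nonneg[OF D] 0
    by (intro integrable_const_bound[where B = 1]) auto
  thus ?case
    using std_exponential_laplace[OF D 0] by simp
next
  case (Suc n)
  define P where "P = (\<Prod>j=2..n+1. real j + a)"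
  have P1: "(\<Prod>j=1..n+1. real j + a) = (1 + a) * P"
    unfolding P_def by (subst prod.atLeast_Suc_atMost) (auto simp: numeral_2_eq_2)
  have "(\<Prod>j=1..n+1. real j + (a + 1)) = (\<Prod>j=2..n+2. real j + a)"
    by (rule prod.reindex_bij_witness[of _ "\<lambda>j. j - 1" Suc]) auto
  also have P2: "\<dots> = P * (real n + 2 + a)"
    unfolding P_def using prod.nat_ivl_Suc'[of 2 "n+1" "\<lambda>j. real j + a"] by (simp add: mult.commute algebra_simps)
  finally have P3: "(\<Prod>j=1..n+1. real j + (a + 1)) = P * (real n + 2 + a)" .
  have P4: "(\<Prod>j=1..Suc n+1. real j + a) = (1 + a) * P * (real n + 2 + a)"
    using P1 by (simp add: algebra_simps)
  have "P > 0" unfolding P_def using Suc.prems by (intro prod_pos) auto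
  have eq: "(1 - exp (- x)) ^ Suc n * exp (- a * x) =
      (1 - exp (- x)) ^ n * exp (- a * x) - (1 - exp (- x)) ^ n * exp (- (a + 1) * x)" for x :: real
    by (simp add: algebra_simps flip: exp_add)
  have IH1: "integrable M (\<lambda>\<omega>. (1 - exp (- X \<omega>)) ^ n * exp (- a * X \<omega>))"
      "expectation (\<lambda>\<omega>. (1 - exp (- X \<omega>)) ^ n * exp (- a * X \<omega>)) = fact n / ((1 + a) * P)"
    using Suc.IH[OF Suc.prems] unfolding P1 by auto
  have IH2: "integrable M (\<lambda>\<omega>. (1 - exp (- X \<omega>)) ^ n * exp (- (a + 1) * X \<omega>))"
      "expectation (\<lambda>\<omega>. (1 - exp (- X \<omega>)) ^ n * exp (- (a + 1) * X \<omega>)) =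
        fact n / (P * (real n + 2 + a))"
    using Suc.IH[of "a + 1"] Suc.prems unfolding P3 by auto
  have "fact n / ((1 + a) * P) - fact n / (P * (real n + 2 + a)) =
    fact (Suc n) / ((1 + a) * P * (real n + 2 + a))"
    using \<open>P > 0\<close> Suc.prems by (simp add: divide_simps) (simp add: algebra_simps)
  thus ?case
    unfolding eq P4 Bochner_Integration.integral_diff[OF IH1(1) IH2(1)] IH1(2) IH2(2)
    using Bochner_Integration.integrable_diff[OF IH1(1) IH2(1)] by blast
qed

lemma std_exponential_greater_prob:
  assumes indep: "indep_var borel Y borel X"
    and D: "distributed M lborel X (exponential_density 1)"
    and nonneg: "AE \<omega> in M. 0 \<le> Y \<omega>"
  shows "expectation (\<lambda>\<omega>. of_bool (Y \<omega> < X \<omega>)) = expectation (\<lambda>\<omega>. exp (- Y \<omega>))"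
proof -
  have [measurable]: "random_variable borel Y" "random_variable borel X"
    using indep by (blast dest: indep_var_rv1 indep_var_rv2)+
  have meas: "(\<lambda>y. expectation (\<lambda>\<omega>'. of_bool (y < X \<omega>') :: real)) \<in> borel_measurable borel"
    by (rule borel_measurable_freeze[OF indep, where C = 1 and h = "\<lambda>y x. of_bool (y < x)"]) auto
  have "expectation (\<lambda>\<omega>. of_bool (Y \<omega> < X \<omega>) :: real) =
      expectation (\<lambda>\<omega>. expectation (\<lambda>\<omega>'. of_bool (Y \<omega> < X \<omega>')))"
    by (rule expectation_freeze[OF indep, where C = 1 and h = "\<lambda>y x. of_bool (y < x)"]) auto
  also have "\<dots> = expectation (\<lambda>\<omega>. exp (- Y \<omega>))"
  proof (rule integral_cong_AE)
    show "(\<lambda>\<omega>. expectation (\<lambda>\<omega>'. of_bool (Y \<omega> < X \<omega>') :: real)) \<in> borel_measurable M"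
      by (rule measurable_compose[OF _ meas]) simp
    show "AE \<omega> in M. expectation (\<lambda>\<omega>'. of_bool (Y \<omega> < X \<omega>')) = exp (- Y \<omega>)"
      using nonneg by eventually_elim (rule std_exponential_tail[OF D])
  qed auto
  finally show ?thesis .
qed

lemma std_exponential_neq_const:
  assumes D: "distributed M lborel X (exponential_density 1)"
  shows "AE \<omega> in M. X \<omega> \<noteq> c"
proof (subst distributed_AE2[OF D])
  have "AE x in lborel. x \<noteq> c" by (rule AE_lborel_singleton)
  thus "AE x in lborel. 0 < ennreal (exponential_density 1 x) \<longrightarrow> x \<noteq> c"
    by eventually_elim auto
qed auto

lemma std_exponential_neq_indep:
  assumes indep: "indep_var borel Y borel X"
    and D: "distributed M lborel X (exponential_density 1)"
  shows "AE \<omega> in M. X \<omega> \<noteq> Y \<omega>"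
proof -
  have [measurable]: "random_variable borel Y" "random_variable borel X"
    using indep by (blast dest: indep_var_rv1 indep_var_rv2)+
  have "expectation (\<lambda>\<omega>. of_bool (X \<omega> = Y \<omega>) :: real) =
      expectation (\<lambda>\<omega>. expectation (\<lambda>\<omega>'. of_bool (X \<omega>' = Y \<omega>)))"
    by (rule expectation_freeze[OF indep, where C = 1 and h = "\<lambda>y x. of_bool (x = y)"]) auto
  also have "\<dots> = expectation (\<lambda>\<omega>. 0)"
  proof (intro Bochner_Integration.integral_cong refl)
    fix \<omega>
    have "expectation (\<lambda>\<omega>'. of_bool (X \<omega>' = Y \<omega>) :: real) = expectation (\<lambda>\<omega>'. 0)"
      by (rule integral_cong_AE) (use std_exponential_neq_const[OF D, of "Y \<omega>"] in auto)
    thus "expectation (\<lambda>\<omega>'. of_bool (X \<omega>' = Y \<omega>) :: real) = 0" by simp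
  qed
  finally have "expectation (\<lambda>\<omega>. of_bool (X \<omega> = Y \<omega>) :: real) = 0" by simp
  hence "AE \<omega> in M. (of_bool (X \<omega> = Y \<omega>) :: real) = 0"
    by (subst (asm) integral_nonneg_eq_0_iff_AE)
       (auto intro!: integrable_const_bound[where B = 1])
  thus ?thesis by eventually_elim auto
qed

end

text \<open>
  The convolution with an exponential variable divided by \<open>n + 1\<close> raises the exponent in the distribution
  function of the maximum of \<open>n\<close> exponentials by one: the integrand is the derivative of
  \<open>x \<mapsto> - (exp (- x / (n + 1)) - exp (- s)) ^ (n + 1)\<close>. The case distinction in \<open>s\<close> keeps the statement
  correct at \<open>n = 0\<close>, where the strict inequality \<open>0 < s\<close> fails at \<open>s = 0\<close> although \<open>0 ^ 0 = 1\<close>.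
\<close>

lemma integral_convolution_step:
  fixes s :: real and n :: nat
  shows "(\<integral>x. exponential_density 1 x * (if s - x / real (Suc n) > 0
      then (1 - exp (- (s - x / real (Suc n)))) ^ n else 0) \<partial>lborel) =
     (if s > 0 then (1 - exp (- s)) ^ Suc n else 0)" (is "?L = _")
proof (cases "s > 0")
  case False
  have "?L = (\<integral>x. 0 \<partial>(lborel :: real measure))"
  proof (intro Bochner_Integration.integral_cong refl)
    fix x :: real
    have "x / real (Suc n) \<ge> 0" if "x \<ge> 0" using that by simp
    hence "\<not> s - x / real (Suc n) > 0" if "x \<ge> 0" using that False by linarith
    thus "exponential_density 1 x * (if s - x / real (Suc n) > 0
      then (1 - exp (- (s - x / real (Suc n)))) ^ n else 0) = 0"
      by (cases "x < 0") (auto simp: exponential_density_def)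
  qed
  with False show ?thesis by simp
next
  case True
  let ?F = "\<lambda>x. - ((exp (- x / real (Suc n)) - exp (- s)) ^ Suc n)"
  let ?f = "\<lambda>x. exp (- x / real (Suc n)) * (exp (- x / real (Suc n)) - exp (- s)) ^ n"
  \<comment> \<open>The closed interval disagrees with the strict inequality only at its right end point when
    \<open>n = 0\<close>; that point is a null set.\<close>
  have eq: "exponential_density 1 x * (if s - x / real (Suc n) > 0
      then (1 - exp (- (s - x / real (Suc n)))) ^ n else 0) =
      ?f x * indicator {0..Suc n * s} x" if "x \<noteq> Suc n * s" for x
  proof -
    define t where "t = x / real (Suc n)"
    have x: "x = real (Suc n) * t" by (simp add: t_def)
    have "exp (- x) = exp (- t) * exp (- t) ^ n"
      by (simp add: x algebra_simps flip: exp_of_nat_mult exp_add)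
    moreover have "exp (- t) ^ n * (1 - exp (- (s - t))) ^ n = (exp (- t) - exp (- s)) ^ n"
      by (simp add: algebra_simps flip: power_mult_distrib exp_add)
    ultimately have "exp (- x) * (1 - exp (- (s - t))) ^ n = exp (- t) * (exp (- t) - exp (- s)) ^ n"
      by (simp add: mult.assoc)
    moreover have "s - t > 0 \<longleftrightarrow> x \<le> Suc n * s"
      using that unfolding x by auto
    moreover have "- x / real (Suc n) = - t" by (simp add: t_def)
    ultimately show ?thesis
      unfolding t_def[symmetric] by (auto simp: exponential_density_def indicator_def)
  qed
  have "?L = (\<integral>x. ?f x * indicator {0..Suc n * s} x \<partial>lborel)"
  proof (rule integral_cong_AE)
    show "AE x in lborel. exponential_density 1 x * (if s - x / real (Suc n) > 0
      then (1 - exp (- (s - x / real (Suc n)))) ^ n else 0) =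
      ?f x * indicator {0..Suc n * s} x"
      using AE_lborel_singleton[of "Suc n * s"] by eventually_elim (rule eq)
  qed auto
  also have "\<dots> = ?F (Suc n * s) - ?F 0"
  proof (rule integral_FTC_Icc_nonneg)
    fix x :: real
    have "((\<lambda>x. - ((exp (- x / c) - e) ^ Suc n)) has_real_derivative
        real (Suc n) / c * (exp (- x / c) * (exp (- x / c) - e) ^ n)) (at x)" if "c > 0" for c e :: real
    proof -
      have "((\<lambda>x. exp (- x / c) - e) has_real_derivative - exp (- x / c) / c) (at x)"
        using that by (auto intro!: derivative_eq_intros)
      from DERIV_minus[OF DERIV_power[OF this, of "Suc n"]] show ?thesis
        by (simp add: mult_ac)
    qed
    from this[of "real (Suc n)" "exp (- s)"] show "DERIV ?F x :> ?f x"
      by simp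
    assume "x \<in> {0..Suc n * s}"
    hence "- s \<le> - x / real (Suc n)"
      by (simp add: divide_simps mult.commute del: of_nat_Suc)
    thus "0 \<le> ?f x" by simp
  qed (use True in auto)
  also have "\<dots> = (1 - exp (- s)) ^ Suc n"
    by (simp del: of_nat_Suc)
  finally show ?thesis using True by simp
qed

context prob_space
begin

text \<open>
  Renyi's representation: the spacings of the order statistics of \<open>n\<close> standard exponentials are distributed as
  \<open>E\<^sub>r / r\<close>, so the sum of the latter has the distribution of the maximum. The induction removes the
  variable that carries the largest weight index, \<open>n + 1\<close>.
\<close>

lemma renyi_sum_cdf:
  assumes "finite I" "indep_vars (\<lambda>_. borel) X I"
    and "\<And>i. i \<in> I \<Longrightarrow> distributed M lborel (X i) (exponential_density 1)"
    and "bij_betw \<sigma> I {1..n}"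
  shows "expectation (\<lambda>\<omega>. of_bool ((\<Sum>m\<in>I. X m \<omega> / real (\<sigma> m)) < s)) =
    (if s > 0 then (1 - exp (- s)) ^ n else (0 :: real))"
  using assms
proof (induction n arbitrary: I s)
  case 0
  hence "I = {}" by (simp add: bij_betw_def)
  thus ?case by (simp add: prob_space)
next
  case (Suc n)
  note I = Suc.prems
  obtain i where i: "i \<in> I" "\<sigma> i = Suc n"
    using I(4) by (auto simp: bij_betw_def image_iff set_eq_iff) force
  define J where "J = I - {i}"
  have J: "finite J" "i \<notin> J" "insert i J = I" "J \<subseteq> I"
    using i I(1) by (auto simp: J_def)
  have bij: "bij_betw \<sigma> J {1..n}"
  proof -
    have "bij_betw \<sigma> J ({1..Suc n} - {Suc n})"
      unfolding J_def using I(4) i by (intro bij_betw_DiffI) (auto simp: bij_betw_def)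
    moreover have "{1..Suc n} - {Suc n} = {1..n}" by auto
    ultimately show ?thesis by simp
  qed
  define S where "S = (\<lambda>\<omega>. \<Sum>m\<in>J. X m \<omega> / real (\<sigma> m))"
  have "indep_vars (\<lambda>_. borel) (\<lambda>m \<omega>. X m \<omega> / real (\<sigma> m)) (insert i J)"
    unfolding J(3) by (rule indep_vars_compose2[OF I(2)]) simp
  from indep_vars_sum[OF J(1,2) this]
  have indep: "indep_var borel (\<lambda>\<omega>. X i \<omega> / real (Suc n)) borel S"
    unfolding S_def i(2) .
  have [measurable]: "random_variable borel (X i)" "random_variable borel S"
    using distributed_measurable[OF I(3)[OF i(1)]] indep by (auto dest: indep_var_rv2)
  have IH: "expectation (\<lambda>\<omega>. of_bool (S \<omega> < t)) = (if t > 0 then (1 - exp (- t)) ^ n else (0 :: real))" for t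
    unfolding S_def using I J bij by (intro Suc.IH indep_vars_subset[OF I(2)]) auto
  have "(\<Sum>m\<in>I. X m \<omega> / real (\<sigma> m)) = X i \<omega> / real (Suc n) + S \<omega>" for \<omega>
    unfolding S_def using J i(2) by (subst J(3)[symmetric], subst sum.insert) auto
  hence "expectation (\<lambda>\<omega>. of_bool ((\<Sum>m\<in>I. X m \<omega> / real (\<sigma> m)) < s)) =
      expectation (\<lambda>\<omega>. of_bool (X i \<omega> / real (Suc n) + S \<omega> < s) :: real)"
    by simp
  also have "\<dots> = expectation (\<lambda>\<omega>. expectation (\<lambda>\<omega>'. of_bool (X i \<omega> / real (Suc n) + S \<omega>' < s)))"
    by (rule expectation_freeze[OF indep, where C = 1 and h = "\<lambda>x y. of_bool (x + y < s)"]) auto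
  also have "\<dots> = expectation (\<lambda>\<omega>. if s - X i \<omega> / real (Suc n) > 0
      then (1 - exp (- (s - X i \<omega> / real (Suc n)))) ^ n else 0)"
    by (subst IH[symmetric]) (simp add: algebra_simps)
  also have "\<dots> = (\<integral>x. exponential_density 1 x * (if s - x / real (Suc n) > 0
      then (1 - exp (- (s - x / real (Suc n)))) ^ n else 0) \<partial>lborel)"
    by (rule distributed_integral[OF I(3)[OF i(1)], symmetric]) auto
  also have "\<dots> = (if s > 0 then (1 - exp (- s)) ^ Suc n else 0)"
    by (rule integral_convolution_step)
  finally show ?case .
qed

end

section \<open>Combinatorics of ranks and maxima\<close>

lemma card_rank_bijections:
  assumes "i \<in> {1..k+1}"
  shows "card (rank_bijections k i) = fact k"
proof -
  have c: "card ({1..k+1} - {i}) = k" using assms by simp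
  have "rank_bijections k i = {\<pi> \<in> ({1..k+1} - {i}) \<rightarrow>\<^sub>E {1..k}. inj_on \<pi> ({1..k+1} - {i})}"
  proof -
    have "bij_betw \<pi> ({1..k+1} - {i}) {1..k}"
      if "\<pi> \<in> ({1..k+1} - {i}) \<rightarrow>\<^sub>E {1..k}" "inj_on \<pi> ({1..k+1} - {i})" for \<pi>
      unfolding bij_betw_def using that c
      by (intro conjI card_subset_eq) (auto simp: card_image)
    thus ?thesis unfolding rank_bijections_def by (auto simp: bij_betw_def)
  qed
  also have "card \<dots> = (\<Prod>j=0..<k. k - j)"
    using card_inj_on_subset_funcset[of "{1..k+1} - {i}" "{1..k}" "{1..k+1} - {i}"] c by simp
  also have "\<dots> = fact k" by (simp add: fact_prod_rev)
  finally show ?thesis .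
qed

text \<open>
  Precomposition with the transposition of \<open>a\<close> and \<open>b\<close>, restricted so as to stay extensional, is an involution
  of the set of bijections.
\<close>

lemma sum_rank_bijections_swap:
  fixes h :: "nat \<Rightarrow> real"
  assumes "a \<in> {1..k+1} - {i}" "b \<in> {1..k+1} - {i}"
  shows "(\<Sum>\<pi>\<in>rank_bijections k i. h (\<pi> a)) = (\<Sum>\<pi>\<in>rank_bijections k i. h (\<pi> b))"
proof -
  define A where "A = {1..k+1} - {i}"
  have R: "\<pi> \<in> rank_bijections k i \<longleftrightarrow> \<pi> \<in> A \<rightarrow>\<^sub>E {1..k} \<and> bij_betw \<pi> A {1..k}" for \<pi>
    by (simp add: rank_bijections_def A_def)
  have ab: "a \<in> A" "b \<in> A" using assms unfolding A_def by auto
  define T where "T = (\<lambda>(\<pi> :: nat \<Rightarrow> nat). \<lambda>x\<in>A. \<pi> (Transposition.transpose a b x))"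
  have tA: "Transposition.transpose a b x \<in> A" if "x \<in> A" for x
    using ab that by (auto simp: Transposition.transpose_def)
  have bt: "bij_betw (Transposition.transpose a b) A A"
    by (rule bij_betw_byWitness[where f' = "Transposition.transpose a b"]) (use tA in auto)
  have T: "T \<pi> \<in> rank_bijections k i" if "\<pi> \<in> rank_bijections k i" for \<pi>
  proof -
    have "bij_betw (\<pi> \<circ> Transposition.transpose a b) A {1..k}"
      using bt that by (intro bij_betw_trans) (auto simp: R)
    moreover have "(\<pi> \<circ> Transposition.transpose a b) x = T \<pi> x" if "x \<in> A" for x
      using that by (simp add: T_def)
    ultimately have "bij_betw (T \<pi>) A {1..k}"
      using bij_betw_cong by blast
    thus ?thesis
      unfolding R by (auto simp: T_def dest: bij_betwE)
  qed
  have TT: "T (T \<pi>) = \<pi>" if "\<pi> \<in> rank_bijections k i" for \<pi>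
  proof
    fix x
    have "\<pi> x = undefined" if "x \<notin> A"
      using \<open>\<pi> \<in> rank_bijections k i\<close> that unfolding R by (blast intro: PiE_arb)
    thus "T (T \<pi>) x = \<pi> x"
      by (cases "x \<in> A") (simp_all add: T_def tA)
  qed
  have Tb: "T \<pi> b = \<pi> a" for \<pi>
    using ab by (simp add: T_def)
  show ?thesis
    by (rule sum.reindex_bij_witness[of _ T T]) (simp_all add: T TT Tb)
qed

text \<open>
  Under a uniformly random bijection the rank of \<open>a\<close> is uniform. Rather than counting the bijections with a
  given value at \<open>a\<close>, the sum is symmetrised: all \<open>k\<close> choices of \<open>a\<close> give the same value, and for one
  bijection their sum runs over all ranks. Multiplying by \<open>k\<close> avoids a division by zero.
\<close>

lemma sum_rank_bijections_eval:
  fixes h :: "nat \<Rightarrow> real"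
  assumes "i \<in> {1..k+1}" "a \<in> {1..k+1} - {i}"
  shows "real k * (\<Sum>\<pi>\<in>rank_bijections k i. h (\<pi> a)) = fact k * (\<Sum>r=1..k. h r)"
proof -
  have "real k * (\<Sum>\<pi>\<in>rank_bijections k i. h (\<pi> a)) =
      (\<Sum>b\<in>{1..k+1} - {i}. \<Sum>\<pi>\<in>rank_bijections k i. h (\<pi> b))"
    using assms by (subst sum.cong[OF refl sum_rank_bijections_swap[OF _ assms(2)]]) auto
  also have "\<dots> = (\<Sum>\<pi>\<in>rank_bijections k i. \<Sum>b\<in>{1..k+1} - {i}. h (\<pi> b))"
    by (rule sum.swap)
  also have "\<dots> = (\<Sum>\<pi>\<in>rank_bijections k i. \<Sum>r=1..k. h r)"
    by (rule sum.cong[OF refl], rule sum.reindex_bij_betw) (simp add: rank_bijections_def)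
  also have "\<dots> = fact k * (\<Sum>r=1..k. h r)"
    using assms(1) by (simp add: card_rank_bijections del: sum_distrib_left)
  finally show ?thesis .
qed

lemma sum_strict_max_indicators:
  fixes x :: "'i \<Rightarrow> 'b :: linorder"
  assumes "finite I" "card I \<ge> 2" "inj_on x I"
  shows "(\<Sum>i\<in>I. of_bool (Max (x ` (I - {i})) < x i)) = (1 :: real)"
proof -
  have "card I \<noteq> 0" using assms(2) by linarith
  hence "I \<noteq> {}" by (metis card.empty)
  hence "Max (x ` I) \<in> x ` I" using assms(1) by (intro Max_in) auto
  then obtain i0 where i0: "i0 \<in> I" "x i0 = Max (x ` I)" by auto
  have "Max (x ` (I - {i})) < x i \<longleftrightarrow> i = i0" if "i \<in> I" for i
  proof -
    have "card (I - {i}) > 0" using assms that by simp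
    hence "I - {i} \<noteq> {}" by (metis card.empty less_irrefl)
    hence "Max (x ` (I - {i})) < x i \<longleftrightarrow> (\<forall>m\<in>I - {i}. x m < x i)"
      using assms(1) by (subst Max_less_iff) auto
    also have "\<dots> \<longleftrightarrow> i = i0"
    proof
      assume less: "\<forall>m\<in>I - {i}. x m < x i"
      show "i = i0"
      proof (rule ccontr)
        assume "i \<noteq> i0"
        with less i0(1) have "x i0 < x i" by blast
        moreover have "x i \<le> x i0" unfolding i0(2) using that assms(1) by (intro Max_ge) auto
        ultimately show False by simp
      qed
    next
      assume i: "i = i0"
      show "\<forall>m\<in>I - {i}. x m < x i"
      proof
        fix m assume m: "m \<in> I - {i}"
        hence "x m \<le> Max (x ` I)" using assms(1) by (intro Max_ge) auto
        moreover have "x m \<noteq> x i0" using inj_onD[OF assms(3), of m i0] m i i0(1) by blast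
        ultimately show "x m < x i" unfolding i i0(2) by (rule order.not_eq_order_implies_strict[rotated])
      qed
    qed
    finally show ?thesis .
  qed
  hence "(\<Sum>i\<in>I. of_bool (Max (x ` (I - {i})) < x i)) = (\<Sum>i\<in>I. of_bool (i = i0) :: real)"
    by (intro sum.cong refl arg_cong[where f = of_bool])
  also have "\<dots> = 1" using assms(1) i0(1) by simp
  finally show ?thesis .
qed

section \<open>The kernel\<close>

text \<open>
  This allows the family of random variables to be replaced by its restriction to
  \<open>{1..k+1}\<close>, on which independence is assumed.
\<close>

lemma Psi_cong:
  assumes "\<And>i. i \<in> {1..k+1} \<Longrightarrow> x i = y i"
  shows "Psi k x = Psi k y"
proof -
  have "x ` ({1..k+1} - {i}) = y ` ({1..k+1} - {i})" for i
    using assms by (intro image_cong) auto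
  moreover have "(\<Sum>m\<in>{1..k+1} - {i}. x m / real (\<pi> m)) = (\<Sum>m\<in>{1..k+1} - {i}. y m / real (\<pi> m))"
    for i and \<pi> :: "nat \<Rightarrow> nat"
    using assms by (intro sum.cong) auto
  ultimately show ?thesis
    unfolding Psi_def using assms by simp
qed

lemma borel_measurable_weighted_sum_less:
  fixes x :: "'b \<Rightarrow> nat \<Rightarrow> real"
  assumes x: "\<And>i. i \<in> {1..k+1} \<Longrightarrow> (\<lambda>\<omega>. x \<omega> i) \<in> borel_measurable N" and i: "i \<in> {1..k+1}"
  shows "(\<lambda>\<omega>. of_bool ((\<Sum>m\<in>{1..k+1} - {i}. x \<omega> m / real (\<pi> m)) < x \<omega> i) :: real) \<in> borel_measurable N"
proof -
  have [measurable]: "(\<lambda>\<omega>. \<Sum>m\<in>{1..k+1} - {i}. x \<omega> m / real (\<pi> m)) \<in> borel_measurable N"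
    using x by (intro borel_measurable_sum borel_measurable_divide) auto
  have [measurable]: "(\<lambda>\<omega>. x \<omega> i) \<in> borel_measurable N" using x i by blast
  show ?thesis by measurable
qed

text \<open>
  For \<open>k \<ge> 1\<close> the maximum is over a nonempty finite set, so comparing with it is a finite conjunction of
  comparisons between coordinates.
\<close>

lemma borel_measurable_Psi:
  assumes k: "k \<ge> 1" and x: "\<And>i. i \<in> {1..k+1} \<Longrightarrow> (\<lambda>\<omega>. x \<omega> i) \<in> borel_measurable N"
  shows "(\<lambda>\<omega>. Psi k (x \<omega>)) \<in> borel_measurable N"
proof -
  have *: "Max (y ` ({1..k+1} - {i})) < y i \<longleftrightarrow> (\<forall>m\<in>{1..k+1} - {i}. y m < y i)"
    if "i \<in> {1..k+1}" for i and y :: "nat \<Rightarrow> real"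
  proof -
    have "card ({1..k+1} - {i}) \<noteq> 0" using that k by simp
    hence "{1..k+1} - {i} \<noteq> {}" by (metis card.empty)
    thus ?thesis by (subst Max_less_iff) auto
  qed
  have m1: "(\<lambda>\<omega>. of_bool (Max (x \<omega> ` ({1..k+1} - {i})) < x \<omega> i) :: real) \<in> borel_measurable N"
    if i: "i \<in> {1..k+1}" for i
  proof -
    have "Measurable.pred N (\<lambda>\<omega>. \<forall>m\<in>{1..k+1} - {i}. x \<omega> m < x \<omega> i)"
    proof (rule pred_intros_finite)
      fix m assume "m \<in> {1..k+1} - {i}"
      hence [measurable]: "(\<lambda>\<omega>. x \<omega> m) \<in> borel_measurable N" "(\<lambda>\<omega>. x \<omega> i) \<in> borel_measurable N"
        using x i by blast+
      show "Measurable.pred N (\<lambda>\<omega>. x \<omega> m < x \<omega> i)" by measurable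
    qed simp
    thus ?thesis unfolding *[OF i] by (rule measurable_compose) simp
  qed
  show ?thesis
    unfolding Psi_def
    by (intro borel_measurable_times borel_measurable_diff borel_measurable_sum borel_measurable_const m1
        borel_measurable_weighted_sum_less x)
qed

lemma abs_Psi_le_1: "\<bar>Psi k x\<bar> \<le> 1"
proof -
  define S1 :: real where "S1 = (\<Sum>i=1..k+1. of_bool (Max (x ` ({1..k+1} - {i})) < x i))"
  define S2 :: real where "S2 = (\<Sum>i=1..k+1. \<Sum>\<pi>\<in>rank_bijections k i.
               of_bool ((\<Sum>m\<in>{1..k+1} - {i}. x m / real (\<pi> m)) < x i))"
  have "S1 \<le> (\<Sum>i=1..k+1. 1)" unfolding S1_def by (intro sum_mono) auto
  hence S1: "S1 \<le> real (k+1)" "S1 \<ge> 0" unfolding S1_def by (auto intro!: sum_nonneg)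
  have "S2 \<le> (\<Sum>i=1..k+1. \<Sum>\<pi>\<in>rank_bijections k i. 1)" unfolding S2_def by (intro sum_mono) auto
  also have "\<dots> = (\<Sum>i=1..k+1. fact k)"
    by (intro sum.cong refl) (simp add: card_rank_bijections)
  also have "\<dots> = real (k+1) * fact k" by simp
  finally have "S2 / fact k \<le> real (k+1)" by (simp add: divide_le_eq)
  moreover have "S2 \<ge> 0" unfolding S2_def by (intro sum_nonneg) simp
  ultimately have S2: "S2 / fact k \<le> real (k+1)" "S2 / fact k \<ge> 0" by auto
  have "Psi k x = (S1 - S2 / fact k) / real (k+1)"
    unfolding Psi_def S1_def S2_def by simp
  moreover have "\<bar>S1 - S2 / fact k\<bar> \<le> real (k+1)" using S1 S2 by linarith
  ultimately show ?thesis by (simp add: abs_divide divide_le_eq del: of_nat_Suc)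
qed

section \<open>The projection\<close>

definition projection_formula :: "nat \<Rightarrow> real \<Rightarrow> real" where
  "projection_formula k s = (1 - (1 - exp (- s)) ^ k) / real (k+1)
          - 1 / (real (k+1))\<^sup>2 * (\<Sum>r=1..k. (1 + 1 / real r) * exp (- s / real r))"

lemma prod_inverse_Suc: "(\<Prod>r=1..k. 1 / (1 + 1 / real r)) = 1 / real (k + 1)"
proof (induction k)
  case (Suc k)
  have "(\<Prod>r=1..Suc k. 1 / (1 + 1 / real r)) = 1 / real (k + 1) * (1 / (1 + 1 / real (Suc k)))"
    using Suc.IH by simp
  also have "\<dots> = 1 / real (Suc k + 1)"
    by (simp add: divide_simps)
  finally show ?case .
qed simp

lemma (in prob_space) indep_var_function_of_others:
  assumes ind: "indep_vars (\<lambda>_. borel) X I" and J: "J \<subseteq> I" "i \<in> I" "i \<notin> J"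
    and g: "g \<in> borel_measurable (PiM J (\<lambda>_. borel))"
  shows "indep_var borel (\<lambda>\<omega>. g (restrict (\<lambda>m. X m \<omega>) J)) borel (X i)"
proof -
  have "indep_var (PiM J (\<lambda>_. borel)) (\<lambda>\<omega>. restrict (\<lambda>m. X m \<omega>) J)
      (PiM {i} (\<lambda>_. borel)) (\<lambda>\<omega>. restrict (\<lambda>m. X m \<omega>) {i})"
    by (rule indep_var_restrict[OF ind]) (use J in auto)
  from indep_var_compose[OF this g, of "\<lambda>x. x i" borel]
  show ?thesis by (simp add: comp_def)
qed

locale iid_exponentials = prob_space M for M :: "'a measure" +
  fixes X :: "nat \<Rightarrow> 'a \<Rightarrow> real" and k :: nat
  assumes k_pos: "k \<ge> 1"
    and indep: "indep_vars (\<lambda>_. borel) X {1..k+1}"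
    and expo: "i \<in> {1..k+1} \<Longrightarrow> distributed M lborel (X i) (exponential_density 1)"
begin

lemma X_measurable [measurable]: "i \<in> {1..k+1} \<Longrightarrow> random_variable borel (X i)"
  using distributed_measurable[OF expo] by simp

lemma X_nonneg: "AE \<omega> in M. \<forall>i\<in>{1..k+1}. 0 \<le> X i \<omega>"
  using std_exponential_nonneg[OF expo] by (subst AE_finite_all) auto

lemma AE_no_ties: "AE \<omega> in M. inj_on ((\<lambda>i. X i \<omega>)(k+1 := s)) {1..k+1}"
proof -
  have "AE \<omega> in M. X i \<omega> \<noteq> X j \<omega>" if "i \<in> {1..k+1}" "j \<in> {1..k+1}" "i \<noteq> j" for i j
  proof -
    have "indep_var borel (X j) borel (X i)"
      using indep_var_function_of_others[OF indep, of "{j}" i "\<lambda>x. x j"] that by simp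
    thus ?thesis by (rule std_exponential_neq_indep[OF _ expo[OF that(1)]])
  qed
  hence "AE \<omega> in M. \<forall>i\<in>{1..k+1}. \<forall>j\<in>{1..k+1}. i \<noteq> j \<longrightarrow> X i \<omega> \<noteq> X j \<omega>"
    by (simp add: AE_finite_all AE_all_countable)
  moreover have "AE \<omega> in M. \<forall>i\<in>{1..k+1}. X i \<omega> \<noteq> s"
    using std_exponential_neq_const[OF expo] by (subst AE_finite_all) auto
  ultimately show ?thesis
    by eventually_elim (auto simp: inj_on_def)
qed

lemma prob_frozen_beats_weighted_sum:
  assumes "s \<ge> 0" "\<pi> \<in> rank_bijections k (k+1)"
  shows "expectation (\<lambda>\<omega>. of_bool ((\<Sum>m\<in>{1..k+1} - {k+1}. ((\<lambda>i. X i \<omega>)(k+1 := s)) m / real (\<pi> m))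
    < ((\<lambda>i. X i \<omega>)(k+1 := s)) (k+1))) = (1 - exp (- s)) ^ k"
proof -
  have bij: "bij_betw \<pi> {1..k} {1..k}"
  proof -
    have "{1..k+1} - {k+1} = {1..k}" by auto
    thus ?thesis using assms(2) by (simp add: rank_bijections_def)
  qed
  have "(\<Sum>m\<in>{1..k+1} - {k+1}. ((\<lambda>i. X i \<omega>)(k+1 := s)) m / real (\<pi> m)) =
      (\<Sum>m\<in>{1..k}. X m \<omega> / real (\<pi> m))" for \<omega>
    by (rule sum.cong) auto
  hence "expectation (\<lambda>\<omega>. of_bool ((\<Sum>m\<in>{1..k+1} - {k+1}. ((\<lambda>i. X i \<omega>)(k+1 := s)) m / real (\<pi> m))
    < ((\<lambda>i. X i \<omega>)(k+1 := s)) (k+1))) =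
    expectation (\<lambda>\<omega>. of_bool ((\<Sum>m\<in>{1..k}. X m \<omega> / real (\<pi> m)) < s) :: real)"
    by simp
  also have "\<dots> = (if s > 0 then (1 - exp (- s)) ^ k else 0)"
    by (rule renyi_sum_cdf[OF _ indep_vars_subset[OF indep] expo bij]) auto
  also have "\<dots> = (1 - exp (- s)) ^ k"
    using \<open>s \<ge> 0\<close> k_pos by (cases "s = 0") auto
  finally show ?thesis .
qed

text \<open>
  The probability is the Laplace transform at 1 of the weighted sum: the frozen term contributes
  \<open>exp (- s / \<pi> (k+1))\<close>, and the others contribute the product of \<open>r / (r + 1)\<close> over all ranks
  except \<open>\<pi> (k+1)\<close>. The product over all ranks is \<open>1 / (k+1)\<close>.
\<close>

lemma prob_other_beats_weighted_sum:
  assumes s: "s \<ge> 0" and i: "i \<in> {1..k}" and \<pi>: "\<pi> \<in> rank_bijections k i"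
  shows "expectation (\<lambda>\<omega>. of_bool ((\<Sum>m\<in>{1..k+1} - {i}. ((\<lambda>i. X i \<omega>)(k+1 := s)) m / real (\<pi> m))
    < ((\<lambda>i. X i \<omega>)(k+1 := s)) i)) =
    (1 + 1 / real (\<pi> (k+1))) * exp (- s / real (\<pi> (k+1))) / real (k+1)"
proof -
  define J where "J = {1..k} - {i}"
  define c where "c = s / real (\<pi> (k+1))"
  define Y where "Y = (\<lambda>\<omega>. c + (\<Sum>m\<in>J. X m \<omega> / real (\<pi> m)))"
  have J: "finite J" "k+1 \<notin> J" "i \<notin> J" "J \<subseteq> {1..k+1}" "{1..k+1} - {i} = insert (k+1) J"
    using i unfolding J_def by auto
  have bij: "bij_betw \<pi> ({1..k+1} - {i}) {1..k}" using \<pi> by (simp add: rank_bijections_def)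
  have "\<pi> (k+1) \<in> {1..k}" using bij i by (auto dest!: bij_betwE)
  hence c0: "c \<ge> 0" unfolding c_def using s by simp
  have sum_eq: "(\<Sum>m\<in>{1..k+1} - {i}. ((\<lambda>i. X i \<omega>)(k+1 := s)) m / real (\<pi> m)) = Y \<omega>" for \<omega>
  proof -
    have "(\<Sum>m\<in>J. ((\<lambda>i. X i \<omega>)(k+1 := s)) m / real (\<pi> m)) = (\<Sum>m\<in>J. X m \<omega> / real (\<pi> m))"
      using J(2) by (intro sum.cong) auto
    thus ?thesis unfolding J(5) Y_def c_def using J(1,2) by simp
  qed
  have ind: "indep_var borel Y borel (X i)"
  proof -
    have "(\<lambda>x. c + (\<Sum>m\<in>J. x m / real (\<pi> m))) \<in> borel_measurable (PiM J (\<lambda>_. borel :: real measure))"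
      by (intro borel_measurable_add borel_measurable_const borel_measurable_sum
          borel_measurable_divide measurable_component_singleton)
    from indep_var_function_of_others[OF indep J(4) _ J(3) this] i
    show ?thesis unfolding Y_def by simp
  qed
  have "AE \<omega> in M. 0 \<le> Y \<omega>"
    using X_nonneg
  proof eventually_elim
    case (elim \<omega>)
    with J(4) c0 show "0 \<le> Y \<omega>"
      unfolding Y_def by (intro add_nonneg_nonneg sum_nonneg divide_nonneg_nonneg) auto
  qed
  with ind have "expectation (\<lambda>\<omega>. of_bool (Y \<omega> < X i \<omega>)) = expectation (\<lambda>\<omega>. exp (- Y \<omega>))"
    using i by (intro std_exponential_greater_prob expo) auto
  also have "\<dots> = expectation (\<lambda>\<omega>. exp (- c) * (\<Prod>m\<in>J. exp (- (1 / real (\<pi> m)) * X m \<omega>)))"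
    by (simp add: Y_def exp_add[symmetric] exp_sum[symmetric] J(1) sum_negf[symmetric] sum_distrib_left del: sum_negf)
  also have "\<dots> = exp (- c) * (\<Prod>m\<in>J. expectation (\<lambda>\<omega>. exp (- (1 / real (\<pi> m)) * X m \<omega>)))"
  proof (subst integral_mult_right_zero, subst indep_vars_lebesgue_integral)
    show "indep_vars (\<lambda>_. borel) (\<lambda>m \<omega>. exp (- (1 / real (\<pi> m)) * X m \<omega>)) J"
      by (rule indep_vars_compose2[OF indep_vars_subset[OF indep J(4)]]) simp
    fix m assume "m \<in> J"
    thus "integrable M (\<lambda>\<omega>. exp (- (1 / real (\<pi> m)) * X m \<omega>))"
      using std_exponential_beta[OF expo, of m "1 / real (\<pi> m)" 0] J(4) by auto
  qed (simp_all add: J(1))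
  also have "(\<Prod>m\<in>J. expectation (\<lambda>\<omega>. exp (- (1 / real (\<pi> m)) * X m \<omega>))) =
      (\<Prod>m\<in>J. 1 / (1 + 1 / real (\<pi> m)))"
    using J(4) by (intro prod.cong refl std_exponential_laplace expo) auto
  also have "(\<Prod>m\<in>J. 1 / (1 + 1 / real (\<pi> m))) = (1 + 1 / real (\<pi> (k+1))) * (1 / real (k+1))"
  proof -
    have "1 / (1 + 1 / real (\<pi> (k+1))) * (\<Prod>m\<in>J. 1 / (1 + 1 / real (\<pi> m))) =
        (\<Prod>m\<in>{1..k+1} - {i}. 1 / (1 + 1 / real (\<pi> m)))"
      unfolding J(5) using J(1,2) by simp
    also have "\<dots> = (\<Prod>r=1..k. 1 / (1 + 1 / real r))"
      using bij by (rule prod.reindex_bij_betw)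
    also have "\<dots> = 1 / real (k+1)" by (rule prod_inverse_Suc)
    moreover have "1 + 1 / real (\<pi> (k+1)) > 0" by (simp add: add_pos_nonneg)
    ultimately show ?thesis by (simp add: divide_eq_eq mult.commute del: of_nat_Suc)
  qed
  finally show ?thesis
    using J i unfolding sum_eq c_def by simp
qed

lemma psi_eq_projection_formula:
  assumes s: "s \<ge> 0"
  shows "psi M X k s = projection_formula k s"
proof -
  define x where "x = (\<lambda>\<omega>. (\<lambda>i. X i \<omega>)(k+1 := s))"
  define G :: "nat \<Rightarrow> (nat \<Rightarrow> nat) \<Rightarrow> 'a \<Rightarrow> real" where
    "G = (\<lambda>i \<pi> \<omega>. of_bool ((\<Sum>m\<in>{1..k+1} - {i}. x \<omega> m / real (\<pi> m)) < x \<omega> i))"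
  define h where "h = (\<lambda>r. (1 + 1 / real r) * exp (- s / real r) / real (k+1))"
  have mx: "(\<lambda>\<omega>. x \<omega> i) \<in> borel_measurable M" if "i \<in> {1..k+1}" for i
    using X_measurable[OF that] unfolding x_def by (cases "i = k + 1") auto
  have mG: "G i \<pi> \<in> borel_measurable M" if "i \<in> {1..k+1}" for i \<pi>
    unfolding G_def by (rule borel_measurable_weighted_sum_less[OF mx that])
  have iG: "integrable M (G i \<pi>)" if "i \<in> {1..k+1}" for i \<pi>
    by (rule integrable_const_bound[where B = 1, OF _ mG[OF that]]) (simp add: G_def)
  have last: "(\<Sum>\<pi>\<in>rank_bijections k (k+1). expectation (G (k+1) \<pi>)) = fact k * (1 - exp (- s)) ^ k"
  proof -
    have "(\<Sum>\<pi>\<in>rank_bijections k (k+1). expectation (G (k+1) \<pi>)) =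
        (\<Sum>\<pi>\<in>rank_bijections k (k+1). (1 - exp (- s)) ^ k)"
      unfolding G_def x_def by (rule sum.cong[OF refl], rule prob_frozen_beats_weighted_sum[OF s])
    thus ?thesis using card_rank_bijections[of "k+1" k] by simp
  qed
  have other: "(\<Sum>\<pi>\<in>rank_bijections k i. expectation (G i \<pi>)) = fact k / real k * (\<Sum>r=1..k. h r)"
    if i: "i \<in> {1..k}" for i
  proof -
    have "(\<Sum>\<pi>\<in>rank_bijections k i. expectation (G i \<pi>)) = (\<Sum>\<pi>\<in>rank_bijections k i. h (\<pi> (k+1)))"
      unfolding G_def x_def h_def by (rule sum.cong[OF refl], rule prob_other_beats_weighted_sum[OF s i])
    moreover have "real k * (\<Sum>\<pi>\<in>rank_bijections k i. h (\<pi> (k+1))) = fact k * (\<Sum>r=1..k. h r)"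
      using i by (intro sum_rank_bijections_eval) auto
    ultimately show ?thesis using k_pos by (simp add: field_simps)
  qed
  have "psi M X k s = expectation (\<lambda>\<omega>. Psi k (x \<omega>))"
    unfolding psi_def x_def ..
  also have "\<dots> = expectation (\<lambda>\<omega>. 1 / real (k+1) *
      (1 - 1 / fact k * (\<Sum>i=1..k+1. \<Sum>\<pi>\<in>rank_bijections k i. G i \<pi> \<omega>)))"
  proof (rule integral_cong_AE)
    show "(\<lambda>\<omega>. Psi k (x \<omega>)) \<in> borel_measurable M"
      by (rule borel_measurable_Psi[OF k_pos mx])
    show "(\<lambda>\<omega>. 1 / real (k+1) * (1 - 1 / fact k * (\<Sum>i=1..k+1. \<Sum>\<pi>\<in>rank_bijections k i. G i \<pi> \<omega>)))
        \<in> borel_measurable M"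
      by (intro borel_measurable_times borel_measurable_diff borel_measurable_sum borel_measurable_const mG)
    show "AE \<omega> in M. Psi k (x \<omega>) = 1 / real (k+1) *
        (1 - 1 / fact k * (\<Sum>i=1..k+1. \<Sum>\<pi>\<in>rank_bijections k i. G i \<pi> \<omega>))"
      using AE_no_ties[of s]
    proof eventually_elim
      case (elim \<omega>)
      hence "(\<Sum>i\<in>{1..k+1}. of_bool (Max (x \<omega> ` ({1..k+1} - {i})) < x \<omega> i)) = (1 :: real)"
        using k_pos unfolding x_def by (intro sum_strict_max_indicators) auto
      thus ?case unfolding Psi_def G_def by simp
    qed
  qed
  also have "\<dots> = 1 / real (k+1) *
      (1 - 1 / fact k * (\<Sum>i=1..k+1. \<Sum>\<pi>\<in>rank_bijections k i. expectation (G i \<pi>)))"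
  proof -
    have int: "integrable M (\<lambda>\<omega>. \<Sum>i=1..k+1. \<Sum>\<pi>\<in>rank_bijections k i. G i \<pi> \<omega>)"
      by (intro Bochner_Integration.integrable_sum iG)
    have "expectation (\<lambda>\<omega>. \<Sum>i=1..k+1. \<Sum>\<pi>\<in>rank_bijections k i. G i \<pi> \<omega>) =
        (\<Sum>i=1..k+1. expectation (\<lambda>\<omega>. \<Sum>\<pi>\<in>rank_bijections k i. G i \<pi> \<omega>))"
      by (intro Bochner_Integration.integral_sum Bochner_Integration.integrable_sum iG)
    also have "\<dots> = (\<Sum>i=1..k+1. \<Sum>\<pi>\<in>rank_bijections k i. expectation (G i \<pi>))"
      by (rule sum.cong[OF refl], rule Bochner_Integration.integral_sum, rule iG)
    finally show ?thesis
      using int by (simp add: prob_space)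
  qed
  also have "(\<Sum>i=1..k+1. \<Sum>\<pi>\<in>rank_bijections k i. expectation (G i \<pi>)) =
      real k * (fact k / real k * (\<Sum>r=1..k. h r)) + fact k * (1 - exp (- s)) ^ k"
    using other last by simp
  also have "1 / real (k+1) * (1 - 1 / fact k * (real k * (fact k / real k * (\<Sum>r=1..k. h r)) +
      fact k * (1 - exp (- s)) ^ k)) = (1 - (1 - exp (- s)) ^ k) / real (k+1) - (\<Sum>r=1..k. h r) / real (k+1)"
  proof -
    have "1 / c * (real k * (c / real k * H) + c * W) = H + W" if "c > 0" for c H W :: real
      using that k_pos by (simp add: field_simps)
    from this[of "fact k"] show ?thesis
      by (simp add: diff_divide_distrib add_divide_distrib)
  qed
  also have "(\<Sum>r=1..k. h r) = (\<Sum>r=1..k. (1 + 1 / real r) * exp (- s / real r)) / real (k+1)"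
    unfolding h_def by (rule sum_divide_distrib[symmetric])
  finally show ?thesis
    unfolding projection_formula_def by (simp add: power2_eq_square)
qed

text \<open>
  The joint measurability of the kernel gives this for all real arguments, so also for negative ones, where the closed
  form does not apply.
\<close>

lemma borel_measurable_psi: "psi M X k \<in> borel_measurable borel"
proof -
  have *: "(\<lambda>z. ((\<lambda>i. X i (snd z))(k+1 := fst z)) i) \<in> borel_measurable (borel \<Otimes>\<^sub>M M)"
    if "i \<in> {1..k+1}" for i
  proof (cases "i = k + 1")
    case False
    have "(\<lambda>z. X i (snd z)) \<in> borel_measurable (borel \<Otimes>\<^sub>M M)"
      using X_measurable[OF that] by (rule measurable_compose[OF measurable_snd])
    thus ?thesis using False by simp
  qed simp
  have "(\<lambda>z. Psi k ((\<lambda>i. X i (snd z))(k+1 := fst z))) \<in> borel_measurable (borel \<Otimes>\<^sub>M M)"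
    by (rule borel_measurable_Psi[OF k_pos *])
  hence "(\<lambda>s. \<integral>\<omega>. Psi k ((\<lambda>i. X i \<omega>)(k+1 := s)) \<partial>M) \<in> borel_measurable borel"
    by (intro borel_measurable_lebesgue_integral) (simp only: case_prod_beta')
  thus ?thesis unfolding psi_def .
qed

lemma abs_psi_le_1: "\<bar>psi M X k s\<bar> \<le> 1"
proof -
  have "\<bar>psi M X k s\<bar> \<le> expectation (\<lambda>\<omega>. \<bar>Psi k ((\<lambda>i. X i \<omega>)(k+1 := s))\<bar>)"
    unfolding psi_def by (rule integral_abs_bound)
  also have "\<dots> \<le> expectation (\<lambda>_. 1)"
    by (rule integral_mono') (auto simp: abs_Psi_le_1)
  finally show ?thesis by (simp add: prob_space)
qed

lemma Psi_random_variable: "(\<lambda>\<omega>. Psi k (\<lambda>i. X i \<omega>)) \<in> borel_measurable M"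
  by (rule borel_measurable_Psi[OF k_pos X_measurable])

text \<open>
  The defining property of the conditional expectation on the events determined by the last variable. It is
  \<open>expectation_freeze\<close> for the last variable, packed as a function on the singleton
  \<open>{k+1}\<close> so that its type agrees with that of the vector of the other variables.
\<close>

lemma expectation_Psi_on_event:
  assumes B: "B \<in> sets borel"
  shows "expectation (\<lambda>\<omega>. indicator B (X (k+1) \<omega>) * Psi k (\<lambda>i. X i \<omega>)) =
    expectation (\<lambda>\<omega>. indicator B (X (k+1) \<omega>) * psi M X k (X (k+1) \<omega>))"
proof -
  define S where "S = PiM {k+1} (\<lambda>_. borel :: real measure)"
  define T where "T = PiM {1..k} (\<lambda>_. borel :: real measure)"
  define Y where "Y = (\<lambda>\<omega>. restrict (\<lambda>i. X i \<omega>) {k+1})"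
  define Z where "Z = (\<lambda>\<omega>. restrict (\<lambda>i. X i \<omega>) {1..k})"
  define h where "h = (\<lambda>y x :: nat \<Rightarrow> real. indicator B (y (k+1)) * Psi k (x(k+1 := y (k+1))))"
  have ind: "indep_var S Y T Z"
    unfolding S_def T_def Y_def Z_def by (rule indep_var_restrict[OF indep]) auto
  have Z_eq: "Psi k ((Z \<omega>)(k+1 := t)) = Psi k ((\<lambda>i. X i \<omega>)(k+1 := t))" for \<omega> t
    by (rule Psi_cong) (auto simp: Z_def)
  have h_meas: "case_prod h \<in> borel_measurable (S \<Otimes>\<^sub>M T)"
  proof -
    have y: "(\<lambda>z. fst z (k+1)) \<in> borel_measurable (S \<Otimes>\<^sub>M T)"
      unfolding S_def by (rule measurable_compose[OF measurable_fst measurable_component_singleton]) simp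
    have x: "(\<lambda>z. ((snd z)(k+1 := fst z (k+1))) i) \<in> borel_measurable (S \<Otimes>\<^sub>M T)" if "i \<in> {1..k+1}" for i
    proof (cases "i = k + 1")
      case False
      have "(\<lambda>z. snd z i) \<in> borel_measurable (S \<Otimes>\<^sub>M T)"
        unfolding T_def by (rule measurable_compose[OF measurable_snd measurable_component_singleton]) (use that False in auto)
      thus ?thesis using False by simp
    qed (use y in simp)
    have "(\<lambda>z. indicator B (fst z (k+1)) :: real) \<in> borel_measurable (S \<Otimes>\<^sub>M T)"
      by (rule measurable_compose[OF y borel_measurable_indicator[OF B]])
    thus ?thesis
      unfolding h_def case_prod_beta' by (intro borel_measurable_times borel_measurable_Psi[OF k_pos x])
  qed
  have "expectation (\<lambda>\<omega>. indicator B (X (k+1) \<omega>) * Psi k (\<lambda>i. X i \<omega>)) = expectation (\<lambda>\<omega>. h (Y \<omega>) (Z \<omega>))"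
  proof -
    have "(\<lambda>i. X i \<omega>)(k+1 := X (k+1) \<omega>) = (\<lambda>i. X i \<omega>)" for \<omega> by auto
    thus ?thesis unfolding h_def Z_eq by (simp add: Y_def)
  qed
  also have "\<dots> = expectation (\<lambda>\<omega>. expectation (\<lambda>\<omega>'. h (Y \<omega>) (Z \<omega>')))"
    by (rule expectation_freeze[OF ind h_meas, where C = 1])
       (use abs_Psi_le_1 in \<open>auto simp: h_def abs_mult indicator_def\<close>)
  also have "\<dots> = expectation (\<lambda>\<omega>. indicator B (X (k+1) \<omega>) * psi M X k (X (k+1) \<omega>))"
    unfolding h_def Z_eq psi_def by (simp add: Y_def)
  finally show ?thesis .
qed

lemma psi_is_conditional_expectation:
  "is_cond_exp_given M (\<lambda>\<omega>. Psi k (\<lambda>i. X i \<omega>)) (X (k+1)) (psi M X k)"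
proof -
  let ?F = "vimage_algebra (space M) (X (k+1)) borel"
  have X[measurable]: "X (k+1) \<in> borel_measurable M" by (rule X_measurable) simp
  note borel_measurable_psi[measurable]
  have sets_F: "sets ?F = {X (k+1) -` B \<inter> space M | B. B \<in> sets borel}"
    by (rule sets_vimage_algebra2) simp
  have sub: "subalgebra M ?F"
    unfolding subalgebra_def sets_F using X by (auto intro: measurable_sets)
  interpret finite_measure_subalgebra M ?F by standard (rule sub)
  have int1: "integrable M (\<lambda>\<omega>. Psi k (\<lambda>i. X i \<omega>))"
    using Psi_random_variable abs_Psi_le_1 by (intro integrable_const_bound[where B = 1]) auto
  have int2: "integrable M (\<lambda>\<omega>. psi M X k (X (k+1) \<omega>))"
    using abs_psi_le_1 by (intro integrable_const_bound[where B = 1]) auto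
  have "AE \<omega> in M. real_cond_exp M ?F (\<lambda>\<omega>. Psi k (\<lambda>i. X i \<omega>)) \<omega> = psi M X k (X (k+1) \<omega>)"
  proof (rule real_cond_exp_charact[OF _ int1 int2])
    have "X (k+1) \<in> measurable ?F borel" by (rule measurable_vimage_algebra1) simp
    thus "(\<lambda>\<omega>. psi M X k (X (k+1) \<omega>)) \<in> borel_measurable ?F"
      by (rule measurable_compose[OF _ borel_measurable_psi])
  next
    fix A assume "A \<in> sets ?F"
    then obtain B where B: "B \<in> sets borel" "A = X (k+1) -` B \<inter> space M"
      unfolding sets_F by blast
    have *: "set_lebesgue_integral M A f = expectation (\<lambda>\<omega>. indicator B (X (k+1) \<omega>) * f \<omega>)" for f :: "'a \<Rightarrow> real"
      unfolding set_lebesgue_integral_def B(2)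
      by (intro Bochner_Integration.integral_cong) (auto simp: indicator_def)
    show "(\<integral>\<omega>\<in>A. Psi k (\<lambda>i. X i \<omega>) \<partial>M) = (\<integral>\<omega>\<in>A. psi M X k (X (k+1) \<omega>) \<partial>M)"
      unfolding * by (rule expectation_Psi_on_event[OF B(1)])
  qed
  with int1 borel_measurable_psi show ?thesis
    unfolding is_cond_exp_given_def by blast
qed

end

section \<open>Moments of the closed form\<close>

text \<open>
  The terms are \<open>1 / (i (i + 2))\<close>, so the sum telescopes with step two.
\<close>

lemma sum_inverse_sq_plus_double:
  "(\<Sum>i=1..k. 1 / real (i + i + i * i)) = 3 / 4 - (2 * real k + 3) / (2 * (real k + 1) * (real k + 2))"
proof (induction k)
  case (Suc k)
  have "(\<Sum>i=1..Suc k. 1 / real (i + i + i * i)) =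
      3 / 4 - (2 * real k + 3) / (2 * (real k + 1) * (real k + 2)) + 1 / ((real k + 1) * (real k + 3))"
    using Suc.IH by (simp add: algebra_simps)
  also have "\<dots> = 3 / 4 - (2 * real (Suc k) + 3) / (2 * (real (Suc k) + 1) * (real (Suc k) + 2))"
    by (simp add: divide_simps add_nonneg_eq_0_iff) (simp add: algebra_simps)
  finally show ?case .
qed simp

lemma sum_square_symmetric:
  fixes q :: "nat \<Rightarrow> nat \<Rightarrow> real"
  assumes sym: "\<And>i j. q i j = q j i"
  shows "(\<Sum>i=1..k. \<Sum>j=1..k. q i j) =
    (\<Sum>i=1..k. q i i) + 2 * (\<Sum>(i, j)\<in>{(i, j). 1 \<le> i \<and> i < j \<and> j \<le> k}. q i j)"
proof -
  define U where "U = {(i, j). 1 \<le> i \<and> i < j \<and> j \<le> k}"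
  define L where "L = {(i, j). 1 \<le> j \<and> j < i \<and> i \<le> k}"
  define D where "D = (\<lambda>i :: nat. (i, i)) ` {1..k}"
  have fin: "finite U" "finite L" "finite D"
    unfolding U_def L_def D_def
    by (auto intro: finite_subset[of _ "{1..k} \<times> {1..k}"])
  have "(\<Sum>i=1..k. \<Sum>j=1..k. q i j) = (\<Sum>(i, j)\<in>{1..k} \<times> {1..k}. q i j)"
    by (rule sum.cartesian_product)
  also have "{1..k} \<times> {1..k} = D \<union> (U \<union> L)"
    unfolding U_def L_def D_def by force
  also have "(\<Sum>(i, j)\<in>D \<union> (U \<union> L). q i j) = (\<Sum>(i, j)\<in>D. q i j) + ((\<Sum>(i, j)\<in>U. q i j) + (\<Sum>(i, j)\<in>L. q i j))"
    using fin by (subst sum.union_disjoint, simp, simp, force simp: U_def L_def D_def,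
        subst sum.union_disjoint) (auto simp: U_def L_def)
  also have "(\<Sum>(i, j)\<in>D. q i j) = (\<Sum>i=1..k. q i i)"
    unfolding D_def by (subst sum.reindex) (auto simp: inj_on_def)
  also have "(\<Sum>(i, j)\<in>L. q i j) = (\<Sum>(i, j)\<in>U. q i j)"
    by (rule sum.reindex_bij_witness[of _ prod.swap prod.swap])
       (auto simp: U_def L_def intro: sym)
  finally show ?thesis unfolding U_def by simp
qed

text \<open>
  The second moment as it arises from termwise integration: squared maximum part, mixed terms,
  and the double sum over ranks, each still unsimplified.
\<close>

definition projection_second_moment :: "nat \<Rightarrow> real" where
  "projection_second_moment k =
     1 / (real (k+1))\<^sup>2 * (1 - 2 * (1 / real (k+1)) + 1 / real (k + k + 1))
     - 2 / (real (k+1)) ^ 3 * (\<Sum>r=1..k. 1 - fact k / (\<Prod>j=2..k+1. real j + 1 / real r))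
     + 1 / (real (k+1)) ^ 4 * (\<Sum>i=1..k. \<Sum>j=1..k. 1 + 1 / real (i + j + i * j))"

context prob_space
begin

lemma has_integral_std_exponential_beta:
  assumes D: "distributed M lborel T (exponential_density 1)" and a: "0 \<le> a"
  shows "has_bochner_integral M (\<lambda>\<omega>. (1 - exp (- T \<omega>)) ^ n * exp (- a * T \<omega>))
    (fact n / (\<Prod>j=1..n+1. real j + a))"
  using std_exponential_beta[OF D a, of n] by (simp add: has_bochner_integral_iff)

lemma has_integral_std_exponential_laplace:
  assumes D: "distributed M lborel T (exponential_density 1)" and a: "0 \<le> a"
  shows "has_bochner_integral M (\<lambda>\<omega>. exp (- a * T \<omega>)) (1 / (1 + a))"
  using has_integral_std_exponential_beta[OF D a, of 0] by simp

lemma has_integral_std_exponential_power: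
  assumes D: "distributed M lborel T (exponential_density 1)"
  shows "has_bochner_integral M (\<lambda>\<omega>. (1 - exp (- T \<omega>)) ^ n) (1 / real (n + 1))"
proof -
  have "(\<Prod>j=1..n+1. real j) = fact (n + 1)" by (simp only: fact_prod of_nat_prod)
  thus ?thesis
    using has_integral_std_exponential_beta[OF D, of 0 n] by (simp del: prod.cl_ivl_Suc)
qed

lemma has_integral_projection_formula:
  assumes D: "distributed M lborel T (exponential_density 1)"
  shows "has_bochner_integral M (\<lambda>\<omega>. projection_formula k (T \<omega>)) 0"
proof -
  have "has_bochner_integral M (\<lambda>\<omega>. (1 - (1 - exp (- T \<omega>)) ^ k) / real (k+1)
          - 1 / (real (k+1))\<^sup>2 * (\<Sum>r=1..k. (1 + 1 / real r) * exp (- (1 / real r) * T \<omega>)))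
     ((1 - 1 / real (k + 1)) / real (k+1)
          - 1 / (real (k+1))\<^sup>2 * (\<Sum>r=1..k. (1 + 1 / real r) * (1 / (1 + 1 / real r))))"
    by (intro has_bochner_integral_diff has_bochner_integral_divide_zero has_bochner_integral_mult_right
        has_bochner_integral_sum has_integral_std_exponential_laplace[OF D]
        has_integral_std_exponential_power[OF D])
       (simp_all add: has_bochner_integral_iff prob_space)
  moreover have "(1 + 1 / real r) * (1 / (1 + 1 / real r)) = 1" for r
    by (simp add: add_nonneg_eq_0_iff)
  moreover have "(1 - 1 / real (k + 1)) / real (k+1) - 1 / (real (k+1))\<^sup>2 * real k = 0"
    by (simp add: power2_eq_square field_simps)
  ultimately show ?thesis
    unfolding projection_formula_def by simp
qed

lemma has_integral_projection_formula_square: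
  assumes D: "distributed M lborel T (exponential_density 1)"
  shows "has_bochner_integral M (\<lambda>\<omega>. (projection_formula k (T \<omega>))\<^sup>2) (projection_second_moment k)"
proof -
  define c where "c = (\<lambda>r :: nat. 1 + 1 / real r)"
  define W where "W = (\<lambda>t :: real. (1 - exp (- t)) ^ k)"
  have c0: "c r > 0" for r unfolding c_def by (simp add: add_pos_nonneg)
  have hW: "has_bochner_integral M (\<lambda>\<omega>. W (T \<omega>)) (1 / real (k+1))"
    unfolding W_def by (rule has_integral_std_exponential_power[OF D])
  have hW2: "has_bochner_integral M (\<lambda>\<omega>. W (T \<omega>) * W (T \<omega>)) (1 / real (k+k+1))"
    using has_integral_std_exponential_power[OF D, of "k+k"] unfolding W_def by (simp add: power_add)
  have hE: "has_bochner_integral M (\<lambda>\<omega>. c r * exp (- T \<omega> / real r)) 1" for r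
    using has_bochner_integral_mult_right[OF has_integral_std_exponential_laplace[OF D, of "1 / real r"], of "c r"]
      c0[of r] by (simp add: c_def)
  have hWE: "has_bochner_integral M (\<lambda>\<omega>. c r * (W (T \<omega>) * exp (- T \<omega> / real r)))
      (fact k / (\<Prod>j=2..k+1. real j + 1 / real r))" for r
  proof -
    have "(\<Prod>j=1..k+1. real j + 1 / real r) = c r * (\<Prod>j=2..k+1. real j + 1 / real r)"
      unfolding c_def by (subst prod.atLeast_Suc_atMost) (auto simp: numeral_2_eq_2)
    hence "c r * (fact k / (\<Prod>j=1..k+1. real j + 1 / real r)) = fact k / (\<Prod>j=2..k+1. real j + 1 / real r)"
      using c0[of r] by (simp del: prod.cl_ivl_Suc)
    thus ?thesis
      using has_bochner_integral_mult_right[OF has_integral_std_exponential_beta[OF D, of "1 / real r" k], of "c r"]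
      by (simp add: W_def del: prod.cl_ivl_Suc)
  qed
  have hEE: "has_bochner_integral M (\<lambda>\<omega>. (c i * exp (- T \<omega> / real i)) * (c j * exp (- T \<omega> / real j)))
      (1 + 1 / real (i + j + i * j))" if ij: "i \<in> {1..k}" "j \<in> {1..k}" for i j
  proof -
    have val: "c i * c j * (1 / (1 + (1 / real i + 1 / real j))) = 1 + 1 / real (i + j + i * j)"
    proof -
      have "(1 + 1 / x) * (1 + 1 / y) * (1 / (1 + (1 / x + 1 / y))) = 1 + 1 / (x + y + x * y)"
        if "x > 0" "y > 0" for x y :: real
      proof -
        have "x + y + x * y > 0" using that by (simp add: add_pos_pos)
        moreover have "1 + (1 / x + 1 / y) = (x + y + x * y) / (x * y)"
          "(1 + 1 / x) * (1 + 1 / y) = (x + y + x * y + 1) / (x * y)"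
          using that by (simp_all add: field_simps)
        moreover have "(s + 1) / p * (1 / (s / p)) = 1 + 1 / s" if "s > 0" "p > 0" for s p :: real
          using that by (simp add: field_simps)
        ultimately show ?thesis using that by simp
      qed
      from this[of "real i" "real j"] show ?thesis
        using ij unfolding c_def by simp
    qed
    have fn: "(c i * exp (- t / real i)) * (c j * exp (- t / real j)) =
        c i * c j * exp (- (1 / real i + 1 / real j) * t)" for t
      by (simp add: algebra_simps flip: exp_add)
    show ?thesis
      unfolding fn val[symmetric]
      by (intro has_bochner_integral_mult_right has_integral_std_exponential_laplace[OF D]) simp
  qed
  have expand: "(projection_formula k t)\<^sup>2 =
     1 / (real (k+1))\<^sup>2 * (1 - 2 * W t + W t * W t)
     - 2 / (real (k+1)) ^ 3 * (\<Sum>r=1..k. c r * exp (- t / real r) - c r * (W t * exp (- t / real r)))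
     + 1 / (real (k+1)) ^ 4 * (\<Sum>i=1..k. \<Sum>j=1..k. (c i * exp (- t / real i)) * (c j * exp (- t / real j)))"
    for t
  proof -
    define E where "E = (\<Sum>r=1..k. c r * exp (- t / real r))"
    have 1: "(\<Sum>r=1..k. c r * exp (- t / real r) - c r * (W t * exp (- t / real r))) = (1 - W t) * E"
      unfolding E_def by (simp add: sum_distrib_left algebra_simps)
    have 2: "(\<Sum>i=1..k. \<Sum>j=1..k. (c i * exp (- t / real i)) * (c j * exp (- t / real j))) = E * E"
      unfolding E_def by (simp only: sum_product)
    have 3: "projection_formula k t = (1 - W t) / real (k+1) - 1 / (real (k+1))\<^sup>2 * E"
      unfolding projection_formula_def E_def W_def c_def ..
    have "((1 - w) / n - 1 / n\<^sup>2 * e)\<^sup>2 = 1 / n\<^sup>2 * (1 - 2 * w + w * w) - 2 / n ^ 3 * ((1 - w) * e) + 1 / n ^ 4 * (e * e)"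
      if "n > 0" for w e n :: real
      using that by (simp add: divide_simps power2_eq_square power3_eq_cube power4_eq_xxxx) (simp add: algebra_simps)
    from this[of "real (k+1)"] show ?thesis
      unfolding 1 2 3 by simp
  qed
  show ?thesis
    unfolding expand projection_second_moment_def
    by (intro has_bochner_integral_add has_bochner_integral_diff has_bochner_integral_mult_right
        has_bochner_integral_sum hW hW2 hE hWE hEE)
       (simp_all add: has_bochner_integral_iff prob_space)
qed

end

lemma projection_second_moment_eq:
  assumes "k \<ge> 1"
  shows "projection_second_moment k = 1 / (real (k+1)) ^ 3 *
          ((- 12 * real k ^ 4 - 38 * real k ^ 3 - 35 * (real k)\<^sup>2 - 11 * real k)
             / (4 * (real k + 1)\<^sup>2 * (real k + 2) * (2 * real k + 1))
           + 2 * fact k * (\<Sum>r=1..k. 1 / (\<Prod>j=2..k+1. real j + 1 / real r))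
           + 2 / real (k+1) *
               (\<Sum>(i, j)\<in>{(i, j). 1 \<le> i \<and> i < j \<and> j \<le> k}. 1 / real (i + j + i * j)))"
proof -
  define P where "P = (\<Sum>r=1..k. 1 / (\<Prod>j=2..k+1. real j + 1 / real r))"
  define Q where "Q = (\<Sum>(i, j)\<in>{(i, j). 1 \<le> i \<and> i < j \<and> j \<le> k}. 1 / real (i + j + i * j))"
  have 1: "(\<Sum>r=1..k. 1 - fact k / (\<Prod>j=2..k+1. real j + 1 / real r)) = real k - fact k * P"
    unfolding P_def by (simp add: sum_subtractf sum_distrib_left)
  have 2: "(\<Sum>i=1..k. \<Sum>j=1..k. 1 + 1 / real (i + j + i * j)) =
      real k * real k + (3 / 4 - (2 * real k + 3) / (2 * (real k + 1) * (real k + 2)) + 2 * Q)"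
  proof -
    have "(\<Sum>i=1..k. \<Sum>j=1..k. 1 / real (i + j + i * j)) = (\<Sum>i=1..k. 1 / real (i + i + i * i)) + 2 * Q"
      unfolding Q_def by (rule sum_square_symmetric) (simp add: ac_simps)
    thus ?thesis unfolding sum_inverse_sq_plus_double by (simp add: sum.distrib)
  qed
  have "1 / (x+1)\<^sup>2 * (1 - 2 * (1 / (x+1)) + 1 / (x + x + 1))
     - 2 / (x+1) ^ 3 * (x - p)
     + 1 / (x+1) ^ 4 * (x * x + (3 / 4 - (2 * x + 3) / (2 * (x + 1) * (x + 2)) + 2 * q)) =
     1 / (x+1) ^ 3 * ((- 12 * x ^ 4 - 38 * x ^ 3 - 35 * x\<^sup>2 - 11 * x)
             / (4 * (x + 1)\<^sup>2 * (x + 2) * (2 * x + 1)) + 2 * p + 2 / (x+1) * q)" if "x > 0" for x p q :: real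
  proof -
    define y where "y = x + 1"
    have R: "y * (1 - 2 * (1 / y) + 1 / (x + x + 1)) - 2 * x
        + 1 / y * (x * x + (3 / 4 - (2 * x + 3) / (2 * y * (x + 2)))) =
        (- 12 * x ^ 4 - 38 * x ^ 3 - 35 * x\<^sup>2 - 11 * x) / (4 * y\<^sup>2 * (x + 2) * (2 * x + 1))"
      using that unfolding y_def
      by (simp add: divide_simps add_pos_pos) (simp add: power2_eq_square power3_eq_cube power4_eq_xxxx algebra_simps)
    have y: "y > 0" using that by (simp add: y_def)
    have "1 / y\<^sup>2 * A - 2 / y ^ 3 * (x - p) + 1 / y ^ 4 * (x * x + (B + 2 * q)) =
        1 / y ^ 3 * ((y * A - 2 * x + 1 / y * (x * x + B)) + 2 * p + 2 / y * q)" for A B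
      using y by (simp add: divide_simps power2_eq_square power3_eq_cube power4_eq_xxxx) (simp add: algebra_simps)
    thus ?thesis unfolding y_def[symmetric] R[symmetric] by simp
  qed
  from this[of "real k" "fact k * P" Q] assms show ?thesis
    unfolding projection_second_moment_def 1 2 P_def[symmetric] Q_def[symmetric]
    by (simp add: add.commute mult.assoc)
qed

section \<open>Non-degeneracy\<close>

lemma harmonic_sum_gt_1:
  assumes "k \<ge> 2"
  shows "(\<Sum>r=1..k. 1 / real r) > 1"
proof -
  have "(\<Sum>r=1..k. 1 / real r) \<ge> (\<Sum>r\<in>{1,2}. 1 / real r)"
    using assms by (intro sum_mono2) auto
  thus ?thesis by simp
qed

text \<open>
  With \<open>H\<close> the harmonic number, the value is \<open>(1 - H) / (k+1)\<^sup>2\<close>.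
\<close>

lemma projection_formula_0_neg:
  assumes "k \<ge> 2"
  shows "projection_formula k 0 < 0"
proof -
  define H where "H = (\<Sum>r=1..k. 1 / real r)"
  have "(\<Sum>r=1..k. (1 + 1 / real r) * exp (- 0 / real r)) = real k + H"
    unfolding H_def by (simp add: sum.distrib)
  hence "projection_formula k 0 = 1 / real (k+1) - 1 / (real (k+1))\<^sup>2 * (real k + H)"
    unfolding projection_formula_def using assms by (simp add: power_0_left)
  also have "\<dots> = (1 - H) / (real (k+1))\<^sup>2"
  proof -
    have "1 / y - 1 / y\<^sup>2 * (y - 1 + H) = (1 - H) / y\<^sup>2" if "y > 0" for y :: real
      using that by (simp add: power2_eq_square field_simps)
    from this[of "real (k+1)"] show ?thesis by simp
  qed
  also have "\<dots> < 0"
    using harmonic_sum_gt_1[OF assms] unfolding H_def by (intro divide_neg_pos) auto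
  finally show ?thesis .
qed

text \<open>
  Otherwise continuity keeps \<open>f\<close> away from zero near 0, which forces \<open>T\<close> to exceed some
  positive bound almost surely, against the tail \<open>exp (- d / 2) < 1\<close>.
\<close>

lemma (in prob_space) isCont_AE_zero_std_exponential:
  fixes f :: "real \<Rightarrow> real"
  assumes D: "distributed M lborel T (exponential_density 1)"
    and f: "isCont f 0" and zero: "AE \<omega> in M. f (T \<omega>) = 0"
  shows "f 0 = 0"
proof (rule ccontr)
  assume nz: "f 0 \<noteq> 0"
  have [measurable]: "random_variable borel T"
    using distributed_measurable[OF D] by simp
  have "\<forall>\<^sub>F x in at 0. f x \<noteq> 0"
    using f nz unfolding isCont_def by (rule tendsto_imp_eventually_ne)
  then obtain d where d: "d > 0" "\<And>x. x \<noteq> 0 \<Longrightarrow> dist x 0 < d \<Longrightarrow> f x \<noteq> 0"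
    unfolding eventually_at by auto
  have "AE \<omega> in M. d / 2 < T \<omega>"
    using zero std_exponential_nonneg[OF D]
  proof eventually_elim
    case (elim \<omega>)
    show ?case
    proof (rule ccontr)
      assume "\<not> d / 2 < T \<omega>"
      with elim d(1) have "dist (T \<omega>) 0 < d" by (simp add: dist_real_def)
      with d(2)[of "T \<omega>"] nz elim(1) show False by (cases "T \<omega> = 0") auto
    qed
  qed
  hence "expectation (\<lambda>\<omega>. of_bool (d / 2 < T \<omega>)) = expectation (\<lambda>_. 1 :: real)"
    by (intro integral_cong_AE) auto
  moreover have "expectation (\<lambda>\<omega>. of_bool (d / 2 < T \<omega>)) = exp (- (d / 2))"
    using d(1) by (intro std_exponential_tail[OF D]) simp
  ultimately show False using d(1) by (simp add: prob_space)
qed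

lemma (in iid_exponentials) projection_moments:
  shows "has_bochner_integral M (\<lambda>\<omega>. psi M X k (X 1 \<omega>)) 0"
    and "has_bochner_integral M (\<lambda>\<omega>. (psi M X k (X 1 \<omega>))\<^sup>2) (projection_second_moment k)"
proof -
  have D: "distributed M lborel (X 1) (exponential_density 1)" by (rule expo) simp
  have [measurable]: "X 1 \<in> borel_measurable M" by (rule X_measurable) simp
  note borel_measurable_psi[measurable]
  have [measurable]: "projection_formula k \<in> borel_measurable borel"
    unfolding projection_formula_def by measurable
  have eq: "AE \<omega> in M. projection_formula k (X 1 \<omega>) = psi M X k (X 1 \<omega>)"
    using std_exponential_nonneg[OF D] by eventually_elim (simp add: psi_eq_projection_formula)
  have eq2: "AE \<omega> in M. (projection_formula k (X 1 \<omega>))\<^sup>2 = (psi M X k (X 1 \<omega>))\<^sup>2"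
    using eq by eventually_elim simp
  show "has_bochner_integral M (\<lambda>\<omega>. psi M X k (X 1 \<omega>)) 0"
    using has_integral_projection_formula[OF D, of k]
    by (subst (asm) has_bochner_integral_cong_AE[OF _ _ eq]) auto
  show "has_bochner_integral M (\<lambda>\<omega>. (psi M X k (X 1 \<omega>))\<^sup>2) (projection_second_moment k)"
    using has_integral_projection_formula_square[OF D, of k]
    by (subst (asm) has_bochner_integral_cong_AE[OF _ _ eq2]) auto
qed

lemma (in iid_exponentials) Delta_sq_eq: "Delta_sq M X k = projection_second_moment k"
  using projection_moments unfolding Delta_sq_def by (simp add: has_bochner_integral_iff)

lemma (in iid_exponentials) Delta_sq_pos:
  assumes "k \<ge> 2"
  shows "Delta_sq M X k > 0"
proof (rule ccontr)
  have D: "distributed M lborel (X 1) (exponential_density 1)" by (rule expo) simp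
  assume "\<not> Delta_sq M X k > 0"
  hence le: "expectation (\<lambda>\<omega>. (psi M X k (X 1 \<omega>))\<^sup>2) \<le> 0"
    using projection_moments(2) by (simp add: Delta_sq_eq has_bochner_integral_iff)
  have int: "integrable M (\<lambda>\<omega>. (psi M X k (X 1 \<omega>))\<^sup>2)"
    using projection_moments(2) by (simp add: has_bochner_integral_iff)
  have "expectation (\<lambda>\<omega>. (psi M X k (X 1 \<omega>))\<^sup>2) = 0"
    using le by (intro antisym integral_nonneg_AE) auto
  hence "AE \<omega> in M. (psi M X k (X 1 \<omega>))\<^sup>2 = 0"
    using int by (subst (asm) integral_nonneg_eq_0_iff_AE) auto
  with std_exponential_nonneg[OF D] have "AE \<omega> in M. projection_formula k (X 1 \<omega>) = 0"
    by eventually_elim (simp add: psi_eq_projection_formula)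
  moreover have "isCont (projection_formula k) 0"
    unfolding projection_formula_def by (intro continuous_intros) auto
  ultimately have "projection_formula k 0 = 0"
    by (intro isCont_AE_zero_std_exponential[OF D])
  with projection_formula_0_neg[OF assms] show False by simp
qed

section \<open>The projection and its variance\<close>

theorem mainTheorem5:
  fixes M :: "'a measure" and X :: "nat \<Rightarrow> 'a \<Rightarrow> real" and k :: nat
  assumes "k \<ge> 2"
    and "prob_space M"
    and "prob_space.indep_vars M (\<lambda>_. borel) X {1..k+1}"
    and "\<And>i. i \<in> {1..k+1} \<Longrightarrow> distributed M lborel (X i) (exponential_density 1)"
  shows "is_cond_exp_given M (\<lambda>\<omega>. Psi k (\<lambda>i. X i \<omega>)) (X (k+1)) (psi M X k)
    \<and> (\<forall>s\<ge>0. psi M X k s =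
          (1 - (1 - exp (- s)) ^ k) / real (k+1)
          - 1 / (real (k+1))\<^sup>2 * (\<Sum>r=1..k. (1 + 1 / real r) * exp (- s / real r)))
    \<and> integrable M (\<lambda>\<omega>. psi M X k (X 1 \<omega>))
    \<and> prob_space.expectation M (\<lambda>\<omega>. psi M X k (X 1 \<omega>)) = 0
    \<and> integrable M (\<lambda>\<omega>. (psi M X k (X 1 \<omega>))\<^sup>2)
    \<and> Delta_sq M X k =
        1 / (real (k+1)) ^ 3 *
          ((- 12 * real k ^ 4 - 38 * real k ^ 3 - 35 * (real k)\<^sup>2 - 11 * real k)
             / (4 * (real k + 1)\<^sup>2 * (real k + 2) * (2 * real k + 1))
           + 2 * fact k * (\<Sum>r=1..k. 1 / (\<Prod>j=2..k+1. real j + 1 / real r))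
           + 2 / real (k+1) *
               (\<Sum>(i, j)\<in>{(i, j). 1 \<le> i \<and> i < j \<and> j \<le> k}. 1 / real (i + j + i * j)))
    \<and> Delta_sq M X k > 0"
proof -
  interpret prob_space M by fact
  interpret iid_exponentials M X k
    using assms by unfold_locales auto
  have k1: "k \<ge> 1" using assms(1) by simp
  show ?thesis
    using psi_is_conditional_expectation psi_eq_projection_formula[unfolded projection_formula_def]
      projection_moments Delta_sq_pos[OF assms(1)]
      Delta_sq_eq[unfolded projection_second_moment_eq[OF k1]]
    unfolding has_bochner_integral_iff by blast
qed

end
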